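(* Let $\mathbf D$ be a generalized divergence and let $\Theta_1,\Theta_2$ be two superchannels (transforming channels $A\to B$ into channels $C\to D$). Consider any $n$-round nested adaptive strategy, consisting of an input state $\rho_{C_1R_1}$, channels $\mathcal A_1,\dots,\mathcal A_{2n-1}$ and a binary measurement $\mathcal Q$, with associated channels $\mathcal N_n$ (when the superchannel is $\Theta_1$) and $\mathcal M_n$ (when it is $\Theta_2$), and let $p$, $q$ be the binary probability distributions obtained by measuring $\mathcal Q$ on $\mathcal N_n(\rho_{C_1R_1})$ and $\mathcal M_n(\rho_{C_1R_1})$, respectively. Then $$\mathbf D(p\|q)\;\le\;\mathbf D\big(\mathcal N_n(\rho_{C_1R_1})\,\big\|\,\mathcal M_n(\rho_{C_1R_1})\big)\;\le\; n\,\mathbf D^{A}(\Theta_1\|\Theta_2).$$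
   Context: All systems are finite-dimensional; channels are completely positive trace-preserving maps; identity maps on systems not acted upon are omitted. $R$ denotes reference systems. Generalized divergence: a function $\mathbf D$ of pairs of states with values in $\mathbb R\cup\{+\infty\}$ with $\mathbf D(\rho\|\sigma)\ge\mathbf D(\mathcal N(\rho)\|\mathcal N(\sigma))$ for all states $\rho,\sigma$ and all channels $\mathcal N$. On probability distributions, $\mathbf D$ is evaluated by viewing them as diagonal states. Amortized channel divergence: for channels $\mathcal N,\mathcal M$ with the same input and output, $\mathbf D^A(\mathcal N\|\mathcal M)=\sup_{\rho,\tau}\big[\mathbf D((\mathcal N\otimes\mathrm{id}_R)(\rho)\|(\mathcal M\otimes\mathrm{id}_R)(\tau))-\mathbf D(\rho\|\tau)\big]$, supremum over states $\rho,\tau$ of input plus reference. Superchannel: $\Theta$ is given by a pair of channels $(\mathcal E_{C\to AS},\mathcal D_{BS\to D})$; it maps a channel $\mathcal N_{AR\to BR}$ to the channel $\Theta(\mathcal N)=(\Theta\otimes\mathrm{id}_R)(\mathcal N)=\mathcal D\circ\mathcal N\circ\mathcal E$ from $CR$ to $DR$. Amortized superchannel divergence: $\mathbf D^{A}(\Theta_1\|\Theta_2)=\sup_{\mathcal N,\mathcal M}\big[\mathbf D^A((\Theta_1\otimes\mathrm{id}_R)(\mathcal N)\|(\Theta_2\otimes\mathrm{id}_R)(\mathcal M))-\mathbf D^A(\mathcal N\|\mathcal M)\big]$, supremum over channels $\mathcal N,\mathcal M$ from $AR$ to $BR$. Nested adaptive strategy with $n$ rounds: define $\mathcal N_1=\Theta_1(\mathcal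 A_n)$, $\mathcal M_1=\Theta_2(\mathcal A_n)$ and, for $i=1,\dots,n-1$, $\mathcal N_{i+1}=\Theta_1(\mathcal A_{n-i}\circ\mathcal N_i\circ\mathcal A_{n+i})$ and $\mathcal M_{i+1}=\Theta_2(\mathcal A_{n-i}\circ\mathcal M_i\circ\mathcal A_{n+i})$, where the $\mathcal A_j$ are arbitrary channels with matching input and output systems (each may act on reference systems but not on the internal memory systems $S$ of the superchannels). The output state is $\mathcal N_n(\rho_{C_1R_1})$ or $\mathcal M_n(\rho_{C_1R_1})$.
   Formalization: The generalized divergence is additionally assumed to satisfy D(ω‖ω) ≤ 0 for every state ω; without this the claim fails, e.g. for the constant D = 1, where the amortized divergences are 0 and the claim reads 1 ≤ 0. *)

theory Defs
  imports
    "Jordan_Normal_Form.Matrix"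
    "Jordan_Normal_Form.Conjugate"
    "HOL-Library.Extended_Real"
begin

text \<open>
  A system is identified with its dimension, an operator on a system of dimension \<open>a\<close> with a matrix
  in \<open>carrier_mat a a\<close>, and a composite system XY of dimensions \<open>x\<close>, \<open>y\<close> with the
  system of dimension \<open>x * y\<close> in which the basis vector \<open>(i, j)\<close> has index \<open>i * y + j\<close>.
\<close>

type_synonym supop = "complex mat \<Rightarrow> complex mat"

definition psd :: "nat \<Rightarrow> complex mat \<Rightarrow> bool" where
  "psd a X \<longleftrightarrow> X \<in> carrier_mat a a \<and> (\<forall>v \<in> carrier_vec a. 0 \<le> conjugate v \<bullet> (X *\<^sub>v v))"

definition tr :: "complex mat \<Rightarrow> complex" where
  "tr X = (\<Sum>i<dim_row X. X $$ (i, i))"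

definition state :: "nat \<Rightarrow> complex mat \<Rightarrow> bool" where
  "state a \<rho> \<longleftrightarrow> psd a \<rho> \<and> tr \<rho> = 1"

definition kron :: "complex mat \<Rightarrow> complex mat \<Rightarrow> complex mat" where
  "kron X Y = mat (dim_row X * dim_row Y) (dim_col X * dim_col Y)
     (\<lambda>(p, q). X $$ (p div dim_row Y, q div dim_col Y) * Y $$ (p mod dim_row Y, q mod dim_col Y))"

text \<open>
  \<open>ext a b r N\<close> is \<open>N \<otimes> id\<close> on an \<open>r\<close>-dimensional second factor, for \<open>N\<close> mapping
  \<open>a\<close>-dimensional to \<open>b\<close>-dimensional operators: \<open>N\<close> is applied to each of the
  \<open>r * r\<close> blocks \<open>block a r X k l = (I \<otimes> \<langle>k|) X (I \<otimes> |l\<rangle>)\<close>; see \<open>ext_kron\<close> below.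
\<close>

definition block :: "nat \<Rightarrow> nat \<Rightarrow> complex mat \<Rightarrow> nat \<Rightarrow> nat \<Rightarrow> complex mat" where
  "block a r X k l = mat a a (\<lambda>(i, j). X $$ (i * r + k, j * r + l))"

definition ext :: "nat \<Rightarrow> nat \<Rightarrow> nat \<Rightarrow> supop \<Rightarrow> supop" where
  "ext a b r N X = mat (b * r) (b * r)
     (\<lambda>(p, q). N (block a r X (p mod r) (q mod r)) $$ (p div r, q div r))"

definition linear_supop :: "nat \<Rightarrow> nat \<Rightarrow> supop \<Rightarrow> bool" where
  "linear_supop a b N \<longleftrightarrow>
     (\<forall>X \<in> carrier_mat a a. N X \<in> carrier_mat b b) \<and>
     (\<forall>X \<in> carrier_mat a a. \<forall>Y \<in> carrier_mat a a. N (X + Y) = N X + N Y) \<and>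
     (\<forall>z. \<forall>X \<in> carrier_mat a a. N (z \<cdot>\<^sub>m X) = z \<cdot>\<^sub>m N X)"

definition completely_positive :: "nat \<Rightarrow> nat \<Rightarrow> supop \<Rightarrow> bool" where
  "completely_positive a b N \<longleftrightarrow> (\<forall>r X. psd (a * r) X \<longrightarrow> psd (b * r) (ext a b r N X))"

definition trace_preserving :: "nat \<Rightarrow> supop \<Rightarrow> bool" where
  "trace_preserving a N \<longleftrightarrow> (\<forall>X \<in> carrier_mat a a. tr (N X) = tr X)"

definition channel :: "nat \<Rightarrow> nat \<Rightarrow> supop \<Rightarrow> bool" where
  "channel a b N \<longleftrightarrow> 0 < a \<and> 0 < b \<and>
     linear_supop a b N \<and> completely_positive a b N \<and> trace_preserving a N"

text \<open>The relabelling of XYZ as XZY, for dimensions \<open>x\<close>, \<open>y\<close>, \<open>z\<close>; see \<open>swap_kron\<close> below.\<close>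

definition swap_index :: "nat \<Rightarrow> nat \<Rightarrow> nat \<Rightarrow> nat" where
  "swap_index y z p = (p div (z * y) * y + p mod y) * z + p div y mod z"

definition swap :: "nat \<Rightarrow> nat \<Rightarrow> nat \<Rightarrow> supop" where
  "swap x y z X = mat (x * z * y) (x * z * y) (\<lambda>(p, q). X $$ (swap_index y z p, swap_index y z q))"

lemma ext_kron:
  assumes N: "linear_supop a b N" and X: "X \<in> carrier_mat a a" and Y: "Y \<in> carrier_mat r r"
  shows "ext a b r N (kron X Y) = kron (N X) Y"
proof (rule eq_matI)
  have NX: "N X \<in> carrier_mat b b" using N X by (auto simp: linear_supop_def)
  have lt: "i * r + k < a * r" if "i < a" "k < r" for i k
  proof -
    have "i * r + k < Suc i * r" using that by simp
    also have "\<dots> \<le> a * r" using that by (intro mult_le_mono1) simp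
    finally show ?thesis .
  qed
  fix p q assume "p < dim_row (kron (N X) Y)" "q < dim_col (kron (N X) Y)"
  hence p: "p < b * r" and q: "q < b * r" using NX Y by (auto simp: kron_def)
  have r: "0 < r" using p by (cases r) auto
  have pq: "p div r < b" "q div r < b" "p mod r < r" "q mod r < r"
    using p q r by (auto simp: less_mult_imp_div_less)
  have "block a r (kron X Y) (p mod r) (q mod r) = Y $$ (p mod r, q mod r) \<cdot>\<^sub>m X"
    using X Y pq r by (intro eq_matI) (auto simp: block_def kron_def lt)
  moreover have "N (Y $$ (p mod r, q mod r) \<cdot>\<^sub>m X) = Y $$ (p mod r, q mod r) \<cdot>\<^sub>m N X"
    using N X by (auto simp: linear_supop_def)
  ultimately show "ext a b r N (kron X Y) $$ (p, q) = kron (N X) Y $$ (p, q)"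
    using p q pq NX Y by (simp add: ext_def kron_def)
qed (use N X Y in \<open>auto simp: ext_def kron_def linear_supop_def\<close>)

lemma swap_kron:
  assumes X: "X \<in> carrier_mat x x" and Y: "Y \<in> carrier_mat y y" and Z: "Z \<in> carrier_mat z z"
  shows "swap x y z (kron (kron X Y) Z) = kron (kron X Z) Y"
proof (rule eq_matI)
  fix p q assume "p < dim_row (kron (kron X Z) Y)" "q < dim_col (kron (kron X Z) Y)"
  hence p: "p < x * z * y" and q: "q < x * z * y" using X Y Z by (auto simp: kron_def)
  have yz: "0 < y" "0 < z" using p by (cases y; cases z; auto)+
  have dm: "swap_index y z p div z = p div (z * y) * y + p mod y"
    "swap_index y z p mod z = p div y mod z" for p
    using yz by (auto simp: swap_index_def)
  have bound: "swap_index y z p < x * y * z \<and> swap_index y z p div z < x * y \<and>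
      p div y < x * z \<and> p div (z * y) < x" if "p < x * z * y" for p
  proof -
    have 1: "p div y < x * z" using that by (simp add: less_mult_imp_div_less)
    have 2: "p div (z * y) < x" using that by (simp add: less_mult_imp_div_less mult.assoc)
    have "p div (z * y) * y + p mod y < Suc (p div (z * y)) * y" using yz by simp
    also have "\<dots> \<le> x * y" using 2 by (intro mult_le_mono1) simp
    finally have 3: "swap_index y z p div z < x * y" by (simp add: dm)
    have "swap_index y z p < x * y * z" using 3 yz by (simp add: div_less_iff_less_mult)
    with 1 2 3 show ?thesis by simp
  qed
  have e: "p div y div z = p div (z * y)" for p
    by (simp add: div_mult2_eq mult.commute[of z])
  show "swap x y z (kron (kron X Y) Z) $$ (p, q) = kron (kron X Z) Y $$ (p, q)"
    using p q bound[OF p] bound[OF q] X Y Z yz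
    by (simp add: swap_def kron_def dm e)
qed (use X Y Z in \<open>auto simp: swap_def kron_def\<close>)

definition generalized_divergence :: "(complex mat \<Rightarrow> complex mat \<Rightarrow> ereal) \<Rightarrow> bool" where
  "generalized_divergence D \<longleftrightarrow>
     (\<forall>a \<rho> \<sigma>. state a \<rho> \<and> state a \<sigma> \<longrightarrow> D \<rho> \<sigma> \<noteq> -\<infinity>) \<and>
     (\<forall>a b N \<rho> \<sigma>. channel a b N \<and> state a \<rho> \<and> state a \<sigma> \<longrightarrow> D (N \<rho>) (N \<sigma>) \<le> D \<rho> \<sigma>)"

text \<open>
  In both amortized divergences the difference is undefined when its subtrahend is infinite, so the
  supremum is restricted to arguments where it is finite.  (In \<^typ>\<open>ereal\<close>,
  \<open>\<infinity> - \<infinity> = \<infinity>\<close>, which would make an unrestricted supremum trivially infinite.)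
\<close>

definition amortized_div ::
    "(complex mat \<Rightarrow> complex mat \<Rightarrow> ereal) \<Rightarrow> nat \<Rightarrow> nat \<Rightarrow> supop \<Rightarrow> supop \<Rightarrow> ereal" where
  "amortized_div D a b N M =
     Sup {D (ext a b r N \<rho>) (ext a b r M \<tau>) - D \<rho> \<tau> | r \<rho> \<tau>.
            state (a * r) \<rho> \<and> state (a * r) \<tau> \<and> D \<rho> \<tau> < \<infinity>}"

record superchannel =
  mem :: nat
  enc :: supop
  dec :: supop

definition is_superchannel :: "nat \<Rightarrow> nat \<Rightarrow> nat \<Rightarrow> nat \<Rightarrow> superchannel \<Rightarrow> bool" where
  "is_superchannel a b c d \<Theta> \<longleftrightarrow>
     channel c (a * mem \<Theta>) (enc \<Theta>) \<and> channel (b * mem \<Theta>) d (dec \<Theta>)"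

text \<open>
  \<open>superapply a b c d \<Theta> r N\<close> is \<open>\<Theta> \<otimes> id\<close> with an \<open>r\<close>-dimensional reference R, applied to
  \<open>N\<close> from AR to BR: the systems run through CR, ASR, ARS, BRS, BSR, DR.
\<close>

definition superapply ::
    "nat \<Rightarrow> nat \<Rightarrow> nat \<Rightarrow> nat \<Rightarrow> superchannel \<Rightarrow> nat \<Rightarrow> supop \<Rightarrow> supop" where
  "superapply a b c d \<Theta> r N = (let s = mem \<Theta> in
     ext (b * s) d r (dec \<Theta>) \<circ> swap b r s \<circ> ext (a * r) (b * r) s N \<circ>
     swap a s r \<circ> ext c (a * s) r (enc \<Theta>))"

definition amortized_superdiv ::
    "(complex mat \<Rightarrow> complex mat \<Rightarrow> ereal) \<Rightarrow> nat \<Rightarrow> nat \<Rightarrow> nat \<Rightarrow> nat \<Rightarrow>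
      superchannel \<Rightarrow> superchannel \<Rightarrow> ereal" where
  "amortized_superdiv D a b c d \<Theta>\<^sub>1 \<Theta>\<^sub>2 =
     Sup {amortized_div D (c * r) (d * r) (superapply a b c d \<Theta>\<^sub>1 r N) (superapply a b c d \<Theta>\<^sub>2 r M)
            - amortized_div D (a * r) (b * r) N M | r N M.
            channel (a * r) (b * r) N \<and> channel (a * r) (b * r) M \<and>
            amortized_div D (a * r) (b * r) N M < \<infinity>}"

text \<open>
  In a nested strategy, \<open>R i\<close> is the dimension of the reference carried by the \<open>i\<close>-th application
  of the superchannel, counted from the innermost one, so the input state lives on the reference
  of dimension \<open>R n\<close>.  The value of \<open>nested\<close> at round 0 is a dummy.
\<close>

definition nested_strategy ::
    "nat \<Rightarrow> nat \<Rightarrow> nat \<Rightarrow> nat \<Rightarrow> nat \<Rightarrow> (nat \<Rightarrow> nat) \<Rightarrow> (nat \<Rightarrow> supop) \<Rightarrow> bool" where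
  "nested_strategy a b c d n R A \<longleftrightarrow>
     channel (a * R 1) (b * R 1) (A n) \<and>
     (\<forall>i \<in> {1..<n}. channel (a * R (i + 1)) (c * R i) (A (n + i)) \<and>
                    channel (d * R i) (b * R (i + 1)) (A (n - i)))"

fun nested ::
    "nat \<Rightarrow> nat \<Rightarrow> nat \<Rightarrow> nat \<Rightarrow> superchannel \<Rightarrow> nat \<Rightarrow> (nat \<Rightarrow> nat) \<Rightarrow> (nat \<Rightarrow> supop) \<Rightarrow> nat \<Rightarrow> supop" where
  "nested a b c d \<Theta> n R A 0 = id"
| "nested a b c d \<Theta> n R A (Suc 0) = superapply a b c d \<Theta> (R 1) (A n)"
| "nested a b c d \<Theta> n R A (Suc (Suc k)) = (let i = Suc k in
     superapply a b c d \<Theta> (R (i + 1)) (A (n - i) \<circ> nested a b c d \<Theta> n R A i \<circ> A (n + i)))"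

definition binary_measurement :: "nat \<Rightarrow> (nat \<Rightarrow> complex mat) \<Rightarrow> bool" where
  "binary_measurement a Q \<longleftrightarrow> psd a (Q 0) \<and> psd a (Q 1) \<and> Q 0 + Q 1 = 1\<^sub>m a"

definition outcome_dist :: "(nat \<Rightarrow> complex mat) \<Rightarrow> complex mat \<Rightarrow> nat \<Rightarrow> real" where
  "outcome_dist Q \<rho> i = Re (tr (Q i * \<rho>))"

definition diag_state :: "(nat \<Rightarrow> real) \<Rightarrow> complex mat" where
  "diag_state p = mat_diag 2 (\<lambda>i. complex_of_real (p i))"

end

theory Submission
  imports Defs
begin

text \<open>
  Data processing makes the amortized channel divergence non-increasing under composition with
  channels on either side, so by definition of the amortized superchannel divergence each round
  adds at most \<open>amortized_superdiv\<close>; the innermost round starts from two equal channels, whose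
  amortized divergence is at most 0.  The input states of the two strategies coincide, so the
  divergence of the outputs is at most the amortized divergence of the final channels.
  The first inequality is data processing for the channel that measures \<open>Q\<close>.
\<close>

section \<open>Positive semidefinite kernels\<close>

text \<open>Two obstacles shape the proof. Complete positivity of the measurement reduces to
  \<open>0 \<le> tr (X * Y)\<close> for positive semidefinite \<open>X\<close> and \<open>Y\<close>.
  It is obtained without spectral decomposition, from kernels on an arbitrary index set, since an
  induction can then delete one index at a time. Divergences are extended reals, so
  \<open>x - y \<le> S\<close> yields \<open>x \<le> S + y\<close> only for finite \<open>y\<close>.
  Finiteness from above is carried along the rounds, with an infinite bound treated apart;
  finiteness from below rests on \<open>D\<close> never being -\<infinity> and on
  \<open>D \<omega> \<omega> \<le> 0\<close>. That normalisation also makes the common input state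
  harmless. Data processing alone would not do: the constant divergence 1 satisfies it, gives
  amortized divergences 0, and violates the second inequality.\<close>

definition pos_semidef :: "'i set \<Rightarrow> ('i \<Rightarrow> 'i \<Rightarrow> complex) \<Rightarrow> bool" where
  "pos_semidef I q \<longleftrightarrow> (\<forall>f. 0 \<le> (\<Sum>i\<in>I. \<Sum>j\<in>I. cnj (f i) * q i j * f j))"

lemma pos_semidefD: "pos_semidef I q \<Longrightarrow> 0 \<le> (\<Sum>i\<in>I. \<Sum>j\<in>I. cnj (f i) * q i j * f j)"
  by (simp add: pos_semidef_def)

lemma pos_semidef_subset:
  assumes "pos_semidef I q" "J \<subseteq> I" "finite I"
  shows "pos_semidef J q"
  unfolding pos_semidef_def
proof
  fix f
  define g :: "_ \<Rightarrow> complex" where "g i = (if i \<in> J then f i else 0)" for i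
  have "0 \<le> (\<Sum>i\<in>I. \<Sum>j\<in>I. cnj (g i) * q i j * g j)"
    using assms(1) by (rule pos_semidefD)
  also have "\<dots> = (\<Sum>i\<in>J. \<Sum>j\<in>I. cnj (g i) * q i j * g j)"
    using assms by (intro sum.mono_neutral_right) (auto simp: g_def)
  also have "\<dots> = (\<Sum>i\<in>J. \<Sum>j\<in>J. cnj (g i) * q i j * g j)"
    using assms by (intro sum.cong refl sum.mono_neutral_right) (auto simp: g_def)
  also have "\<dots> = (\<Sum>i\<in>J. \<Sum>j\<in>J. cnj (f i) * q i j * f j)"
    by (intro sum.cong) (auto simp: g_def)
  finally show "0 \<le> (\<Sum>i\<in>J. \<Sum>j\<in>J. cnj (f i) * q i j * f j)" .
qed

lemma pos_semidef_diag:
  assumes "pos_semidef I q" "i \<in> I" "finite I"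
  shows "0 \<le> q i i"
  using pos_semidefD[OF pos_semidef_subset[OF assms(1), of "{i}"], of "\<lambda>_. 1"] assms by simp

lemma pos_semidef_pair:
  assumes "pos_semidef I q" "finite I" "i \<in> I" "j \<in> I" "i \<noteq> j"
  shows "0 \<le> cnj \<alpha> * q i i * \<alpha> + cnj \<alpha> * q i j * \<beta> + cnj \<beta> * q j i * \<alpha> + cnj \<beta> * q j j * \<beta>"
  using pos_semidefD[OF pos_semidef_subset[OF assms(1), of "{i, j}"],
      of "\<lambda>k. if k = i then \<alpha> else \<beta>"] assms
  by (simp add: algebra_simps)

text \<open>In the complex order \<open>0 \<le> z\<close> forces \<open>z\<close> to be real.
  Reality of the form at the test vectors (1, 1) and (1, \<i>) fixes the imaginary and the real part
  of \<open>q j i\<close>.\<close>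

lemma pos_semidef_hermitian:
  assumes "pos_semidef I q" "finite I" "i \<in> I" "j \<in> I"
  shows "q j i = cnj (q i j)"
proof (cases "i = j")
  case True
  with pos_semidef_diag[OF assms(1,3,2)] show ?thesis
    by (auto simp: complex_eq_iff less_eq_complex_def)
next
  case False
  note P = pos_semidef_pair[OF assms False]
  have "Im (q i i) = 0" "Im (q j j) = 0"
    using pos_semidef_diag[OF assms(1)] assms by (auto simp: less_eq_complex_def)
  with P[of 1 1] P[of 1 \<i>] show ?thesis
    by (auto simp: complex_eq_iff less_eq_complex_def)
qed

lemma pos_semidef_zero_diag:
  assumes "pos_semidef I q" "finite I" "i \<in> I" "j \<in> I" "q i i = 0"
  shows "q i j = 0"
proof (rule ccontr)
  assume nz: "q i j \<noteq> 0"
  with assms have ne: "i \<noteq> j" by auto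
  define m where "m = (cmod (q i j))\<^sup>2"
  have m: "m > 0" using nz by (simp add: m_def)
  \<comment> \<open>Testing with \<open>- s * q i j\<close> at \<open>i\<close> and 1 at
    \<open>j\<close> gives \<open>- 2 * s * m + Re (q j j)\<close>; this \<open>s\<close> makes it
    \<open>- Re (q j j) - 2\<close>, which is negative.\<close>
  define s where "s = (Re (q j j) + 1) / m"
  have h: "q j i = cnj (q i j)" by (rule pos_semidef_hermitian) (use assms in auto)
  have mm: "q i j * cnj (q i j) = of_real m"
    unfolding m_def by (rule complex_norm_square[symmetric])
  have "0 \<le> - (2 * of_real s * (q i j * cnj (q i j))) + q j j"
    using pos_semidef_pair[OF assms(1-4) ne, of "- of_real s * q i j" 1] assms(5) h
    by (simp add: algebra_simps)
  hence "0 \<le> - 2 * s * m + Re (q j j)"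
    unfolding mm by (simp add: less_eq_complex_def)
  hence "Re (q j j) + 2 \<le> 0" using m by (simp add: s_def)
  moreover have "0 \<le> Re (q j j)"
    using pos_semidef_diag[OF assms(1,4,2)] by (simp add: less_eq_complex_def)
  ultimately show False by simp
qed

text \<open>
  Induction on the index set: in the step, \<open>q\<close> is the sum of a rank-one kernel and its Schur
  complement with respect to \<open>x\<close>, which vanishes in row and column \<open>x\<close>.
\<close>

lemma pos_semidef_trace_product:
  assumes "finite I" "pos_semidef I q" "pos_semidef I w"
  shows "0 \<le> (\<Sum>i\<in>I. \<Sum>j\<in>I. q i j * w j i)"
  using assms
proof (induction I arbitrary: q rule: finite_induct)
  case empty
  then show ?case by simp
next
  case (insert x I)
  let ?J = "insert x I"
  have fin: "finite ?J" using insert by simp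
  have w: "pos_semidef I w" using pos_semidef_subset[OF insert.prems(2)] fin by auto
  have herm: "q j i = cnj (q i j)" if "i \<in> ?J" "j \<in> ?J" for i j
    by (rule pos_semidef_hermitian[OF insert.prems(1) fin that])
  show ?case
  proof (cases "q x x = 0")
    case True
    have z: "q x i = 0" "q i x = 0" if "i \<in> ?J" for i
      using pos_semidef_zero_diag[OF insert.prems(1) fin _ that True] herm[OF _ that, of x] by auto
    have "pos_semidef I q" using pos_semidef_subset[OF insert.prems(1)] fin by auto
    hence "0 \<le> (\<Sum>i\<in>I. \<Sum>j\<in>I. q i j * w j i)" by (rule insert.IH[OF _ w])
    also have "\<dots> = (\<Sum>i\<in>?J. \<Sum>j\<in>?J. q i j * w j i)"
      using insert.hyps z by simp
    finally show ?thesis .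
  next
    case False
    define e where "e = q x x"
    have e: "e \<noteq> 0" "0 \<le> e"
      using False pos_semidef_diag[OF insert.prems(1) _ fin, of x] by (auto simp: e_def)
    define r where "r i j = q i j - q i x * q x j / e" for i j
    have rx: "r x i = 0" "r i x = 0" for i using e by (auto simp: r_def e_def)
    have "pos_semidef I r"
      unfolding pos_semidef_def
    proof
      fix f
      define S where "S = (\<Sum>j\<in>I. q x j * f j)"
      define T where "T = (\<Sum>i\<in>I. cnj (f i) * q i x)"
      define F where "F = (\<Sum>i\<in>I. \<Sum>j\<in>I. cnj (f i) * q i j * f j)"
      \<comment> \<open>The value at \<open>x\<close> minimises the form of \<open>q\<close> over
        that coordinate. It cancels the factor \<open>e * g x + S\<close>, and what remains is the
        form of the Schur complement \<open>r\<close> at \<open>f\<close>.\<close>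
      define g where "g = f(x := - S / e)"
      have g: "g i = f i" if "i \<in> I" for i using that insert.hyps by (auto simp: g_def)
      have gx: "g x = - S / e" by (simp add: g_def)
      have "0 \<le> (\<Sum>i\<in>?J. \<Sum>j\<in>?J. cnj (g i) * q i j * g j)"
        using insert.prems(1) by (rule pos_semidefD)
      also have "\<dots> = cnj (g x) * (e * g x + S) + T * g x + F"
      proof -
        have "(\<Sum>j\<in>?J. cnj (g i) * q i j * g j)
            = cnj (g i) * q i x * g x + (\<Sum>j\<in>I. cnj (g i) * q i j * f j)" for i
          using insert.hyps g by simp
        moreover have "(\<Sum>j\<in>I. cnj (g x) * q x j * f j) = cnj (g x) * S"
          by (simp add: S_def sum_distrib_left mult.assoc)
        moreover have "(\<Sum>i\<in>I. cnj (g i) * q i x * g x) = T * g x"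
          unfolding T_def sum_distrib_right using g by (intro sum.cong) auto
        moreover have "(\<Sum>i\<in>I. \<Sum>j\<in>I. cnj (g i) * q i j * f j) = F"
          unfolding F_def using g by (intro sum.cong) auto
        ultimately show ?thesis
          using insert.hyps by (simp add: sum.distrib e_def algebra_simps)
      qed
      also have "\<dots> = F - T * S / e"
        using e by (simp add: gx)
      also have "\<dots> = (\<Sum>i\<in>I. \<Sum>j\<in>I. cnj (f i) * r i j * f j)"
      proof -
        have "T * S / e = (\<Sum>i\<in>I. \<Sum>j\<in>I. cnj (f i) * (q i x * q x j / e) * f j)"
          by (simp add: T_def S_def sum_product sum_divide_distrib mult.assoc)
        thus ?thesis
          by (simp add: F_def r_def algebra_simps sum_subtractf)
      qed
      finally show "0 \<le> (\<Sum>i\<in>I. \<Sum>j\<in>I. cnj (f i) * r i j * f j)" .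
    qed
    hence "0 \<le> (\<Sum>i\<in>I. \<Sum>j\<in>I. r i j * w j i)" by (rule insert.IH[OF _ w])
    also have "\<dots> = (\<Sum>i\<in>?J. \<Sum>j\<in>?J. r i j * w j i)"
      using insert.hyps rx by simp
    finally have R: "0 \<le> (\<Sum>i\<in>?J. \<Sum>j\<in>?J. r i j * w j i)" .
    \<comment> \<open>The rank-one part contributes the form of \<open>w\<close> at column
      \<open>x\<close> of \<open>q\<close>, divided by \<open>e\<close>; hermitian symmetry turns
      \<open>cnj (q j x)\<close> into \<open>q x j\<close>.\<close>
    have "0 \<le> (\<Sum>j\<in>?J. \<Sum>i\<in>?J. cnj (q j x) * w j i * q i x)"
      using insert.prems(2) by (rule pos_semidefD)
    also have "\<dots> = (\<Sum>i\<in>?J. \<Sum>j\<in>?J. cnj (q j x) * w j i * q i x)"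
      by (rule sum.swap)
    also have "\<dots> = (\<Sum>i\<in>?J. \<Sum>j\<in>?J. q i x * q x j * w j i)"
      using herm by (intro sum.cong refl) (metis insertI1 mult.commute mult.left_commute)
    finally have "0 \<le> (\<Sum>i\<in>?J. \<Sum>j\<in>?J. q i x * q x j * w j i) / e"
      using e by (auto simp: less_eq_complex_def complex_eq_iff Re_divide Im_divide)
    with R have "0 \<le> (\<Sum>i\<in>?J. \<Sum>j\<in>?J. r i j * w j i) + (\<Sum>i\<in>?J. \<Sum>j\<in>?J. q i x * q x j * w j i) / e"
      by (simp add: less_eq_complex_def)
    also have "\<dots> = (\<Sum>i\<in>?J. \<Sum>j\<in>?J. q i j * w j i)"
      unfolding sum_divide_distrib sum.distrib[symmetric]
      using e by (intro sum.cong refl) (simp add: r_def field_simps)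
    finally show ?thesis .
  qed
qed

section \<open>From kernels to matrices\<close>

lemma psd_iff: "psd a X \<longleftrightarrow> X \<in> carrier_mat a a \<and> pos_semidef {..<a} (\<lambda>i j. X $$ (i, j))"
proof (cases "X \<in> carrier_mat a a")
  case True
  have form: "conjugate v \<bullet> (X *\<^sub>v v) = (\<Sum>i<a. \<Sum>j<a. cnj (v $ i) * X $$ (i, j) * v $ j)"
    if "v \<in> carrier_vec a" for v
    using that True
    by (auto simp: scalar_prod_def lessThan_atLeast0 sum_distrib_left mult.assoc intro!: sum.cong)
  show ?thesis
  proof
    assume P: "psd a X"
    have "0 \<le> (\<Sum>i<a. \<Sum>j<a. cnj (f i) * X $$ (i, j) * f j)" for f
    proof -
      have "0 \<le> conjugate (vec a f) \<bullet> (X *\<^sub>v vec a f)" using P by (simp add: psd_def)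
      thus ?thesis by (simp add: form)
    qed
    thus "X \<in> carrier_mat a a \<and> pos_semidef {..<a} (\<lambda>i j. X $$ (i, j))"
      using True by (simp add: pos_semidef_def)
  next
    assume "X \<in> carrier_mat a a \<and> pos_semidef {..<a} (\<lambda>i j. X $$ (i, j))"
    thus "psd a X" by (auto simp: psd_def form pos_semidef_def)
  qed
qed (auto simp: psd_def)

text \<open>Serves twice: it makes outcome probabilities real, and through
  \<open>psd_partial_trace\<close> it makes the measurement completely positive.\<close>

lemma tr_mult_nonneg:
  assumes "psd a X" "psd a Y"
  shows "0 \<le> tr (X * Y)"
proof -
  have c: "X \<in> carrier_mat a a" "Y \<in> carrier_mat a a" using assms by (auto simp: psd_def)
  have "tr (X * Y) = (\<Sum>i<a. \<Sum>j<a. X $$ (i, j) * Y $$ (j, i))"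
    using c by (auto simp: tr_def scalar_prod_def lessThan_atLeast0 intro!: sum.cong)
  thus ?thesis
    using pos_semidef_trace_product[of "{..<a}"] assms by (simp add: psd_iff)
qed

section \<open>Closure properties of channels\<close>

lemma sum_split_index:
  "(\<Sum>p<a * r. f p) = (\<Sum>i<a. \<Sum>k<r. f (i * r + k))" for f :: "nat \<Rightarrow> 'b::comm_monoid_add"
proof -
  have "sum f {i * r..<i * r + r} = (\<Sum>k<r. f (i * r + k))" for i
    using sum.shift_bounds_nat_ivl[of f 0 "i * r" r] by (simp add: lessThan_atLeast0 add.commute)
  thus ?thesis by (simp add: sum.nat_group[symmetric])
qed

lemma index_less:
  fixes a r :: nat
  assumes "i < a" "k < r"
  shows "i * r + k < a * r"
proof -
  have "i * r + k < Suc i * r" using assms by simp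
  also have "\<dots> \<le> a * r" using assms by (intro mult_le_mono1) simp
  finally show ?thesis .
qed

lemma div_less_mod_less:
  fixes a r p :: nat
  assumes "p < a * r"
  shows "p div r < a" "p mod r < r"
  using assms by (cases r; auto simp: less_mult_imp_div_less)+

section \<open>Ampliation of maps by a reference system\<close>

lemma block_carrier [simp]: "block a r X k l \<in> carrier_mat a a"
  by (simp add: block_def)

lemma ext_carrier [simp]: "ext a b r N X \<in> carrier_mat (b * r) (b * r)"
  by (simp add: ext_def)

lemma ext_comp:
  assumes "\<And>X. X \<in> carrier_mat a a \<Longrightarrow> N X \<in> carrier_mat b b"
  shows "ext b c r M (ext a b r N X) = ext a c r (M \<circ> N) X"
proof (rule eq_matI)
  fix p q assume "p < dim_row (ext a c r (M \<circ> N) X)" "q < dim_col (ext a c r (M \<circ> N) X)"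
  hence p: "p < c * r" and q: "q < c * r" by (auto simp: ext_def)
  note pq = div_less_mod_less[OF p] div_less_mod_less[OF q]
  have "block b r (ext a b r N X) (p mod r) (q mod r) = N (block a r X (p mod r) (q mod r))"
    using assms[OF block_carrier, of r X "p mod r" "q mod r"] pq
    by (intro eq_matI) (auto simp: block_def ext_def index_less)
  thus "ext b c r M (ext a b r N X) $$ (p, q) = ext a c r (M \<circ> N) X $$ (p, q)"
    using p q by (simp add: ext_def)
qed (auto simp: ext_def)

text \<open>A trivial reference extracts positivity from complete positivity and admits inputs
  without reference in \<open>amortized_div\<close>. The dimension is written \<open>Suc 0\<close>
  because the simplifier rewrites 1 to it.\<close>

lemma ext_one:
  assumes "X \<in> carrier_mat a a" "N X \<in> carrier_mat b b"
  shows "ext a b (Suc 0) N X = N X"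
proof -
  have "block a (Suc 0) X 0 0 = X" using assms by (intro eq_matI) (auto simp: block_def)
  thus ?thesis using assms by (intro eq_matI) (auto simp: ext_def)
qed

text \<open>Associativity of the tensor product: two references act as one of dimension
  \<open>r * s\<close>. Complete positivity of \<open>N\<close>, which covers every reference,
  thereby passes to \<open>ext a b r N\<close>.\<close>

lemma ext_ext: "ext (a * r) (b * r) s (ext a b r N) X = ext a b (r * s) N X"
proof (rule eq_matI)
  fix p q assume "p < dim_row (ext a b (r * s) N X)" "q < dim_col (ext a b (r * s) N X)"
  hence p: "p < b * r * s" and q: "q < b * r * s" by (auto simp: ext_def mult.assoc)
  note pq = div_less_mod_less[OF p] div_less_mod_less[OF q]
  have pq': "p div s mod r < r" "q div s mod r < r"
    using div_less_mod_less[OF pq(1)] div_less_mod_less[OF pq(3)] by auto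
  have m: "t mod (r * s) = t div s mod r * s + t mod s" "t div (r * s) = t div s div r" for t
    by (simp_all add: mod_mult2_eq div_mult2_eq mult.commute[of r])
  have "block a r (block (a * r) s X (p mod s) (q mod s)) (p div s mod r) (q div s mod r)
      = block a (r * s) X (p mod (r * s)) (q mod (r * s))"
    using pq' by (intro eq_matI) (auto simp: block_def index_less m algebra_simps)
  thus "ext (a * r) (b * r) s (ext a b r N) X $$ (p, q) = ext a b (r * s) N X $$ (p, q)"
    using p q pq by (simp add: ext_def m mult.assoc[symmetric])
qed (auto simp: ext_def)

section \<open>Channels, their composition and their ampliation\<close>

lemma channelD:
  assumes "channel a b N"
  shows "0 < a" "0 < b"
    and "\<And>X. X \<in> carrier_mat a a \<Longrightarrow> N X \<in> carrier_mat b b"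
    and "\<And>X Y. X \<in> carrier_mat a a \<Longrightarrow> Y \<in> carrier_mat a a \<Longrightarrow> N (X + Y) = N X + N Y"
    and "\<And>X z. X \<in> carrier_mat a a \<Longrightarrow> N (z \<cdot>\<^sub>m X) = z \<cdot>\<^sub>m N X"
    and "\<And>r X. psd (a * r) X \<Longrightarrow> psd (b * r) (ext a b r N X)"
    and "\<And>X. X \<in> carrier_mat a a \<Longrightarrow> tr (N X) = tr X"
  using assms
  by (auto simp: channel_def linear_supop_def completely_positive_def trace_preserving_def)

lemma channelI:
  assumes "0 < a" "0 < b"
    and "\<And>X. X \<in> carrier_mat a a \<Longrightarrow> N X \<in> carrier_mat b b"
    and "\<And>X Y. X \<in> carrier_mat a a \<Longrightarrow> Y \<in> carrier_mat a a \<Longrightarrow> N (X + Y) = N X + N Y"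
    and "\<And>X z. X \<in> carrier_mat a a \<Longrightarrow> N (z \<cdot>\<^sub>m X) = z \<cdot>\<^sub>m N X"
    and "\<And>r X. psd (a * r) X \<Longrightarrow> psd (b * r) (ext a b r N X)"
    and "\<And>X. X \<in> carrier_mat a a \<Longrightarrow> tr (N X) = tr X"
  shows "channel a b N"
  using assms
  by (auto simp: channel_def linear_supop_def completely_positive_def trace_preserving_def)

lemma psd_carrier: "psd a X \<Longrightarrow> X \<in> carrier_mat a a"
  by (simp add: psd_def)

lemma state_carrier: "state a X \<Longrightarrow> X \<in> carrier_mat a a"
  by (simp add: state_def psd_def)

lemma channel_state:
  assumes "channel a b N" "state a \<rho>"
  shows "state b (N \<rho>)"
proof -
  have c: "\<rho> \<in> carrier_mat a a" by (rule state_carrier[OF assms(2)])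
  have "psd (b * 1) (ext a b 1 N \<rho>)"
    using assms by (intro channelD(6)) (auto simp: state_def)
  thus ?thesis
    using assms c channelD[OF assms(1)] by (simp add: ext_one[of _ a _ b] state_def)
qed

lemma channel_comp:
  assumes N: "channel a b N" and M: "channel b c M"
  shows "channel a c (M \<circ> N)"
proof (rule channelI)
  fix r X assume "psd (a * r) X"
  hence "psd (c * r) (ext b c r M (ext a b r N X))" by (intro channelD(6)[OF M] channelD(6)[OF N])
  thus "psd (c * r) (ext a c r (M \<circ> N) X)" using channelD(3)[OF N] by (simp add: ext_comp)
qed (use channelD[OF N] channelD[OF M] in auto)

lemma tr_ext_sum: "tr (ext a b r N X) = (\<Sum>k<r. \<Sum>i<b. N (block a r X k k) $$ (i, i))"
proof -
  have "tr (ext a b r N X) = (\<Sum>i<b. \<Sum>k<r. N (block a r X k k) $$ (i, i))"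
    by (auto simp: tr_def ext_def sum_split_index index_less intro!: sum.cong)
  also have "\<dots> = (\<Sum>k<r. \<Sum>i<b. N (block a r X k k) $$ (i, i))" by (rule sum.swap)
  finally show ?thesis .
qed

lemma channel_ext:
  assumes N: "channel a b N" and r: "0 < r"
  shows "channel (a * r) (b * r) (ext a b r N)"
proof (rule channelI)
  note n = channelD[OF N]
  show "0 < a * r" "0 < b * r" using n r by auto
  fix X :: "complex mat" assume X: "X \<in> carrier_mat (a * r) (a * r)"
  show "ext a b r N X \<in> carrier_mat (b * r) (b * r)" by simp
  show "tr (ext a b r N X) = tr X"
  proof -
    \<comment> \<open>Only diagonal blocks enter the trace, and \<open>N\<close> preserves the trace
      of each.\<close>
    have "(\<Sum>i<b. N (block a r X k k) $$ (i, i)) = tr (block a r X k k)" for k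
    proof -
      have "N (block a r X k k) \<in> carrier_mat b b" by (rule n) simp
      hence "(\<Sum>i<b. N (block a r X k k) $$ (i, i)) = tr (N (block a r X k k))"
        by (auto simp: tr_def)
      thus ?thesis using n(7)[OF block_carrier] by simp
    qed
    hence "tr (ext a b r N X) = (\<Sum>k<r. tr (block a r X k k))" by (simp add: tr_ext_sum)
    also have "\<dots> = (\<Sum>k<r. \<Sum>i<a. X $$ (i * r + k, i * r + k))"
      by (simp add: tr_def block_def)
    also have "\<dots> = (\<Sum>i<a. \<Sum>k<r. X $$ (i * r + k, i * r + k))" by (rule sum.swap)
    also have "\<dots> = tr X" using X by (simp add: tr_def sum_split_index)
    finally show ?thesis .
  qed
  show "ext a b r N (z \<cdot>\<^sub>m X) = z \<cdot>\<^sub>m ext a b r N X" for z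
  proof (rule eq_matI)
    fix p q assume "p < dim_row (z \<cdot>\<^sub>m ext a b r N X)" "q < dim_col (z \<cdot>\<^sub>m ext a b r N X)"
    hence p: "p < b * r" and q: "q < b * r" by (auto simp: ext_def)
    note pq = div_less_mod_less[OF p] div_less_mod_less[OF q]
    have "block a r (z \<cdot>\<^sub>m X) (p mod r) (q mod r) = z \<cdot>\<^sub>m block a r X (p mod r) (q mod r)"
      using X pq by (intro eq_matI) (auto simp: block_def index_less)
    thus "ext a b r N (z \<cdot>\<^sub>m X) $$ (p, q) = (z \<cdot>\<^sub>m ext a b r N X) $$ (p, q)"
      using p q pq n(3)[OF block_carrier, of r X "p mod r" "q mod r"] by (simp add: ext_def n(5))
  qed (auto simp: ext_def)
  show "ext a b r N (X + Y) = ext a b r N X + ext a b r N Y"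
    if Y: "Y \<in> carrier_mat (a * r) (a * r)" for Y
  proof (rule eq_matI)
    fix p q assume "p < dim_row (ext a b r N X + ext a b r N Y)"
      "q < dim_col (ext a b r N X + ext a b r N Y)"
    hence p: "p < b * r" and q: "q < b * r" by (auto simp: ext_def)
    note pq = div_less_mod_less[OF p] div_less_mod_less[OF q]
    have "block a r (X + Y) (p mod r) (q mod r)
        = block a r X (p mod r) (q mod r) + block a r Y (p mod r) (q mod r)"
      using X Y pq by (intro eq_matI) (auto simp: block_def index_less)
    thus "ext a b r N (X + Y) $$ (p, q) = (ext a b r N X + ext a b r N Y) $$ (p, q)"
      using p q pq n(3)[OF block_carrier, of r X "p mod r" "q mod r"]
        n(3)[OF block_carrier, of r Y "p mod r" "q mod r"]
      by (simp add: ext_def n(4))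
  qed (auto simp: ext_def)
next
  fix s X assume "psd (a * r * s) X"
  hence "psd (b * (r * s)) (ext a b (r * s) N X)"
    by (intro channelD(6)[OF N]) (simp add: mult.assoc)
  thus "psd (b * r * s) (ext (a * r) (b * r) s (ext a b r N) X)"
    by (simp add: ext_ext mult.assoc)
qed

section \<open>Relabelling tensor factors\<close>

lemma psd_reindex:
  assumes X: "psd m X" and \<pi>: "\<And>p. p < n \<Longrightarrow> \<pi> p < m"
  shows "psd n (mat n n (\<lambda>(p, q). X $$ (\<pi> p, \<pi> q)))"
proof -
  have "0 \<le> (\<Sum>p<n. \<Sum>q<n. cnj (f p) * X $$ (\<pi> p, \<pi> q) * f q)" for f
  proof -
    \<comment> \<open>\<open>g\<close> pushes \<open>f\<close> forward along \<open>\<pi>\<close> by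
      summing over fibres, so the reindexed form at \<open>f\<close> is the form of \<open>X\<close>
      at \<open>g\<close>.\<close>
    define g where "g i = (\<Sum>p<n. if \<pi> p = i then f p else 0)" for i
    have c: "(\<Sum>i<m. cnj (g i) * h i) = (\<Sum>p<n. cnj (f p) * h (\<pi> p))" for h
    proof -
      have "(\<Sum>i<m. cnj (g i) * h i) = (\<Sum>i<m. \<Sum>p<n. if \<pi> p = i then cnj (f p) * h i else 0)"
        by (auto simp: g_def sum_distrib_right intro!: sum.cong)
      also have "\<dots> = (\<Sum>p<n. \<Sum>i<m. if \<pi> p = i then cnj (f p) * h i else 0)" by (rule sum.swap)
      also have "\<dots> = (\<Sum>p<n. cnj (f p) * h (\<pi> p))" using \<pi> by (intro sum.cong) auto
      finally show ?thesis .
    qed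
    have d: "(\<Sum>i<m. h i * g i) = (\<Sum>p<n. h (\<pi> p) * f p)" for h
    proof -
      have "cnj (\<Sum>i<m. h i * g i) = cnj (\<Sum>p<n. h (\<pi> p) * f p)"
        using c[of "\<lambda>i. cnj (h i)"] by (simp add: mult.commute)
      thus ?thesis by (simp only: complex_cnj_cancel_iff)
    qed
    have "0 \<le> (\<Sum>i<m. \<Sum>j<m. cnj (g i) * X $$ (i, j) * g j)"
      using X by (intro pos_semidefD) (simp add: psd_iff)
    also have "\<dots> = (\<Sum>p<n. \<Sum>q<n. cnj (f p) * X $$ (\<pi> p, \<pi> q) * f q)"
      using c[of "\<lambda>i. \<Sum>q<n. X $$ (i, \<pi> q) * f q"] d
      by (simp add: mult.assoc sum_distrib_left[symmetric])
    finally show ?thesis .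
  qed
  thus ?thesis by (simp add: psd_iff pos_semidef_def)
qed

lemma swap_index_split:
  "j < y \<Longrightarrow> k < z \<Longrightarrow> swap_index y z ((i * z + k) * y + j) = (i * y + j) * z + k"
  by (simp add: swap_index_def div_mult2_eq mult.commute[of z y])

lemma swap_index_less:
  assumes "p < x * z * y"
  shows "swap_index y z p < x * y * z"
proof -
  note p = div_less_mod_less[OF assms] div_less_mod_less[OF div_less_mod_less(1)[OF assms]]
  have "p = (p div y div z * z + p div y mod z) * y + p mod y" by simp
  hence "swap_index y z p = (p div y div z * y + p mod y) * z + p div y mod z"
    using swap_index_split p by metis
  thus ?thesis using p by (simp add: index_less)
qed

lemma channel_swap:
  assumes "0 < x" "0 < y" "0 < z"
  shows "channel (x * y * z) (x * z * y) (swap x y z)"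
proof (rule channelI)
  fix X :: "complex mat" assume X: "X \<in> carrier_mat (x * y * z) (x * y * z)"
  show "tr (swap x y z X) = tr X"
  proof -
    have "tr (swap x y z X) = (\<Sum>i<x. \<Sum>k<z. \<Sum>j<y. X $$ ((i * y + j) * z + k, (i * y + j) * z + k))"
      by (auto simp: tr_def swap_def sum_split_index index_less swap_index_split intro!: sum.cong)
    also have "\<dots> = (\<Sum>i<x. \<Sum>j<y. \<Sum>k<z. X $$ ((i * y + j) * z + k, (i * y + j) * z + k))"
      by (intro sum.cong refl sum.swap)
    also have "\<dots> = tr X" using X by (simp add: tr_def sum_split_index)
    finally show ?thesis .
  qed
next
  fix r X assume P: "psd (x * y * z * r) X"
  \<comment> \<open>The reference only adds a trailing index, so the ampliated swap is again a
    relabelling of matrix entries.\<close>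
  have "ext (x * y * z) (x * z * y) r (swap x y z) X = mat (x * z * y * r) (x * z * y * r)
      (\<lambda>(p, q). X $$ (swap_index y z (p div r) * r + p mod r, swap_index y z (q div r) * r + q mod r))"
    (is "_ = ?Y")
  proof (rule eq_matI)
    fix p q assume "p < dim_row ?Y" "q < dim_col ?Y"
    hence p: "p < x * z * y * r" and q: "q < x * z * y * r" by auto
    show "ext (x * y * z) (x * z * y) r (swap x y z) X $$ (p, q) = ?Y $$ (p, q)"
      using p q div_less_mod_less(1)[OF p] div_less_mod_less(1)[OF q]
      by (simp add: ext_def swap_def block_def swap_index_less)
  qed (simp_all add: ext_def)
  also have "psd (x * z * y * r) \<dots>"
    by (intro psd_reindex[OF P] index_less swap_index_less div_less_mod_less)
  finally show "psd (x * z * y * r) (ext (x * y * z) (x * z * y) r (swap x y z) X)" .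
qed (use assms in \<open>auto simp: swap_def swap_index_less intro!: eq_matI\<close>)

lemma channel_superapply:
  assumes \<Theta>: "is_superchannel a b c d \<Theta>" and N: "channel (a * r) (b * r) N"
  shows "channel (c * r) (d * r) (superapply a b c d \<Theta> r N)"
proof -
  define s where "s = mem \<Theta>"
  have E: "channel c (a * s) (enc \<Theta>)" and F: "channel (b * s) d (dec \<Theta>)"
    using \<Theta> by (auto simp: is_superchannel_def s_def)
  \<comment> \<open>\<open>channel_ext\<close> and \<open>channel_swap\<close> require positive
    dimensions; these are read off the channels whose systems contain them as factors.\<close>
  have pos: "0 < a" "0 < b" "0 < s" "0 < r"
    using channelD(1,2)[OF E] channelD(1,2)[OF N] channelD(1)[OF F] by auto
  have "channel (c * r) (a * s * r) (ext c (a * s) r (enc \<Theta>))"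
    using channel_ext[OF E] pos by simp
  moreover have "channel (a * s * r) (a * r * s) (swap a s r)"
    using pos by (intro channel_swap)
  moreover have "channel (a * r * s) (b * r * s) (ext (a * r) (b * r) s N)"
    using pos by (intro channel_ext[OF N])
  moreover have "channel (b * r * s) (b * s * r) (swap b r s)"
    using pos by (intro channel_swap)
  moreover have "channel (b * s * r) (d * r) (ext (b * s) d r (dec \<Theta>))"
    using channel_ext[OF F] pos by simp
  ultimately show ?thesis
    unfolding superapply_def Let_def s_def[symmetric] by (intro channel_comp)
qed

section \<open>The measurement channel\<close>

text \<open>The quantum-to-classical map of the measurement. Unlike \<open>outcome_dist\<close> it
  takes no real part, which keeps it complex linear.\<close>

definition measure_channel :: "(nat \<Rightarrow> complex mat) \<Rightarrow> supop" where
  "measure_channel Q X = mat_diag 2 (\<lambda>i. tr (Q i * X))"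

lemma tr_add: "X \<in> carrier_mat a a \<Longrightarrow> Y \<in> carrier_mat a a \<Longrightarrow> tr (X + Y) = tr X + tr Y"
  by (auto simp: tr_def sum.distrib)

lemma tr_smult: "X \<in> carrier_mat a a \<Longrightarrow> tr (z \<cdot>\<^sub>m X) = z * tr X"
  by (auto simp: tr_def sum_distrib_left)

text \<open>Contracting the reference with \<open>g\<close> turns \<open>X\<close> into a positive
  semidefinite \<open>W\<close> on the measured system, and the form in question at \<open>g\<close>
  is \<open>tr (Q * W)\<close>. In other words, the functional \<open>tr (Q * X)\<close> is
  completely positive.\<close>

lemma psd_partial_trace:
  assumes Q: "psd a Q" and X: "psd (a * r) X"
  shows "pos_semidef {..<r} (\<lambda>k l. tr (Q * block a r X k l))"
  unfolding pos_semidef_def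
proof
  fix g
  define W where "W = mat a a (\<lambda>(t, s). \<Sum>k<r. \<Sum>l<r. cnj (g k) * X $$ (t * r + k, s * r + l) * g l)"
  have "psd a W"
    unfolding psd_iff pos_semidef_def
  proof (intro conjI allI)
    fix h
    \<comment> \<open>\<open>X\<close> is tested on the product vector with entries
      \<open>h t * g k\<close>.\<close>
    have "0 \<le> (\<Sum>p<a * r. \<Sum>q<a * r.
        cnj (h (p div r) * g (p mod r)) * X $$ (p, q) * (h (q div r) * g (q mod r)))"
      using X by (intro pos_semidefD) (simp add: psd_iff)
    also have "\<dots> = (\<Sum>t<a. \<Sum>k<r. \<Sum>s<a. \<Sum>l<r.
        cnj (h t) * (cnj (g k) * X $$ (t * r + k, s * r + l) * g l) * h s)"
      unfolding sum_split_index by (intro sum.cong refl) (simp add: ac_simps)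
    also have "\<dots> = (\<Sum>t<a. \<Sum>s<a. \<Sum>k<r. \<Sum>l<r.
        cnj (h t) * (cnj (g k) * X $$ (t * r + k, s * r + l) * g l) * h s)"
      by (intro sum.cong refl sum.swap)
    also have "\<dots> = (\<Sum>t<a. \<Sum>s<a. cnj (h t) * W $$ (t, s) * h s)"
      by (intro sum.cong refl) (simp add: W_def sum_distrib_left sum_distrib_right)
    finally show "0 \<le> (\<Sum>t<a. \<Sum>s<a. cnj (h t) * W $$ (t, s) * h s)" .
  qed (simp add: W_def)
  with Q have "0 \<le> tr (Q * W)" by (rule tr_mult_nonneg)
  have form: "tr (Q * Y) = (\<Sum>s<a. \<Sum>t<a. Q $$ (s, t) * Y $$ (t, s))"
    if "Y \<in> carrier_mat a a" for Y
    using that psd_carrier[OF Q]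
    by (auto simp: tr_def scalar_prod_def lessThan_atLeast0 intro!: sum.cong)
  have "tr (Q * W) = (\<Sum>s<a. \<Sum>t<a. \<Sum>k<r. \<Sum>l<r.
      Q $$ (s, t) * (cnj (g k) * X $$ (t * r + k, s * r + l) * g l))"
    by (subst form) (auto simp: W_def sum_distrib_left intro!: sum.cong)
  also have "\<dots> = (\<Sum>k<r. \<Sum>l<r. \<Sum>s<a. \<Sum>t<a.
      Q $$ (s, t) * (cnj (g k) * X $$ (t * r + k, s * r + l) * g l))"
    (is "(\<Sum>s<a. \<Sum>t<a. \<Sum>k<r. \<Sum>l<r. ?F s t k l) = _")
  proof -
    have "(\<Sum>s<a. \<Sum>t<a. \<Sum>k<r. \<Sum>l<r. ?F s t k l) = (\<Sum>s<a. \<Sum>k<r. \<Sum>t<a. \<Sum>l<r. ?F s t k l)"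
      by (intro sum.cong refl sum.swap)
    also have "\<dots> = (\<Sum>k<r. \<Sum>s<a. \<Sum>t<a. \<Sum>l<r. ?F s t k l)" by (rule sum.swap)
    also have "\<dots> = (\<Sum>k<r. \<Sum>s<a. \<Sum>l<r. \<Sum>t<a. ?F s t k l)"
      by (intro sum.cong refl sum.swap)
    also have "\<dots> = (\<Sum>k<r. \<Sum>l<r. \<Sum>s<a. \<Sum>t<a. ?F s t k l)"
      by (intro sum.cong refl sum.swap)
    finally show ?thesis .
  qed
  also have "\<dots> = (\<Sum>k<r. \<Sum>l<r. cnj (g k) * tr (Q * block a r X k l) * g l)"
    by (intro sum.cong refl)
      (simp add: form block_def sum_distrib_left sum_distrib_right ac_simps)
  finally show "0 \<le> (\<Sum>k<r. \<Sum>l<r. cnj (g k) * tr (Q * block a r X k l) * g l)"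
    using \<open>0 \<le> tr (Q * W)\<close> by simp
qed

lemma channel_measure:
  assumes Q: "binary_measurement a Q" and a: "0 < a"
  shows "channel a 2 (measure_channel Q)"
proof (rule channelI)
  have P: "psd a (Q i)" if "i < 2" for i
    using Q that by (auto simp: binary_measurement_def less_2_cases_iff)
  have C: "Q i \<in> carrier_mat a a" if "i < 2" for i using psd_carrier P that by blast
  show "0 < a" by fact
  show "measure_channel Q X \<in> carrier_mat 2 2" for X
    by (simp add: measure_channel_def)
  show "measure_channel Q (X + Y) = measure_channel Q X + measure_channel Q Y"
    if X: "X \<in> carrier_mat a a" and Y: "Y \<in> carrier_mat a a" for X Y
  proof -
    have "tr (Q i * (X + Y)) = tr (Q i * X) + tr (Q i * Y)" if "i < 2" for i
      using X Y C[OF that] by (simp add: mult_add_distrib_mat tr_add[of _ a])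
    thus ?thesis by (intro eq_matI) (auto simp: measure_channel_def mat_diag_def)
  qed
  show "measure_channel Q (z \<cdot>\<^sub>m X) = z \<cdot>\<^sub>m measure_channel Q X"
    if X: "X \<in> carrier_mat a a" for X z
  proof -
    have "tr (Q i * (z \<cdot>\<^sub>m X)) = z * tr (Q i * X)" if "i < 2" for i
    proof -
      have "Q i * X \<in> carrier_mat a a" using X C[OF that] by auto
      thus ?thesis using X C[OF that] by (simp add: mult_smult_distrib tr_smult[of _ a])
    qed
    thus ?thesis by (intro eq_matI) (auto simp: measure_channel_def mat_diag_def)
  qed
  show "tr (measure_channel Q X) = tr X" if X: "X \<in> carrier_mat a a" for X
  proof -
    have "tr (measure_channel Q X) = tr (Q 0 * X) + tr (Q 1 * X)"
      by (simp add: tr_def measure_channel_def mat_diag_def numeral_2_eq_2)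
    also have "\<dots> = tr (Q 0 * X + Q 1 * X)"
      using X C[of 0] C[of 1] by (intro tr_add[symmetric, of _ a]) auto
    also have "Q 0 * X + Q 1 * X = (Q 0 + Q 1) * X"
      using X C[of 0] C[of 1] by (intro add_mult_distrib_mat[symmetric]) auto
    also have "\<dots> = X" using Q X by (simp add: binary_measurement_def)
    finally show ?thesis .
  qed
  show "psd (2 * r) (ext a 2 r (measure_channel Q) X)" if X: "psd (a * r) X" for r X
    unfolding psd_iff pos_semidef_def
  proof (intro conjI allI)
    fix f
    let ?Y = "ext a 2 r (measure_channel Q) X"
    \<comment> \<open>The output is block diagonal in the outcome index, so its form splits into one
      form from \<open>psd_partial_trace\<close> per outcome.\<close>
    have Y: "?Y $$ (i * r + k, j * r + l) = (if i = j then tr (Q i * block a r X k l) else 0)"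
      if "i < 2" "j < 2" "k < r" "l < r" for i j k l
      using that index_less[of i 2 k r] index_less[of j 2 l r]
      by (simp add: ext_def measure_channel_def mat_diag_def)
    have "0 \<le> (\<Sum>i<2. \<Sum>k<r. \<Sum>l<r.
        cnj (f (i * r + k)) * tr (Q i * block a r X k l) * f (i * r + l))"
      using X by (intro sum_nonneg pos_semidefD psd_partial_trace P) auto
    also have "\<dots> = (\<Sum>i<2. \<Sum>k<r. \<Sum>j<2. \<Sum>l<r.
        cnj (f (i * r + k)) * ?Y $$ (i * r + k, j * r + l) * f (j * r + l))"
    proof (rule sum.cong[OF refl], rule sum.cong[OF refl])
      fix i k assume i: "i \<in> {..<2::nat}" and k: "k \<in> {..<r}"
      have "(\<Sum>j<2. \<Sum>l<r. cnj (f (i * r + k)) * ?Y $$ (i * r + k, j * r + l) * f (j * r + l))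
          = (\<Sum>j<2. if i = j then
              \<Sum>l<r. cnj (f (i * r + k)) * tr (Q i * block a r X k l) * f (i * r + l) else 0)"
        using i k by (intro sum.cong refl) (auto simp: Y)
      also have "\<dots> = (\<Sum>l<r. cnj (f (i * r + k)) * tr (Q i * block a r X k l) * f (i * r + l))"
        using i by simp
      finally show "(\<Sum>l<r. cnj (f (i * r + k)) * tr (Q i * block a r X k l) * f (i * r + l))
          = (\<Sum>j<2. \<Sum>l<r. cnj (f (i * r + k)) * ?Y $$ (i * r + k, j * r + l) * f (j * r + l))" ..
    qed
    also have "\<dots> = (\<Sum>p<2 * r. \<Sum>q<2 * r. cnj (f p) * ?Y $$ (p, q) * f q)"
      by (simp only: sum_split_index)
    finally show "0 \<le> (\<Sum>p<2 * r. \<Sum>q<2 * r. cnj (f p) * ?Y $$ (p, q) * f q)" .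
  qed simp
qed simp

text \<open>The traces are nonnegative in the complex order, hence real, so the \<open>Re\<close> in
  \<open>outcome_dist\<close> discards nothing.\<close>

lemma diag_state_outcome:
  assumes "binary_measurement a Q" "psd a \<rho>"
  shows "diag_state (outcome_dist Q \<rho>) = measure_channel Q \<rho>"
proof -
  have "complex_of_real (Re (tr (Q i * \<rho>))) = tr (Q i * \<rho>)" if "i < 2" for i
  proof -
    have "psd a (Q i)" using assms that by (auto simp: binary_measurement_def less_2_cases_iff)
    from tr_mult_nonneg[OF this assms(2)] show ?thesis
      by (auto simp: less_eq_complex_def complex_eq_iff)
  qed
  thus ?thesis
    by (intro eq_matI) (auto simp: diag_state_def outcome_dist_def measure_channel_def mat_diag_def)
qed

section \<open>Amortized divergences\<close>

lemma generalized_divergenceD: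
  assumes "generalized_divergence D" "state a \<rho>" "state a \<sigma>"
  shows "D \<rho> \<sigma> \<noteq> -\<infinity>" "channel a b N \<Longrightarrow> D (N \<rho>) (N \<sigma>) \<le> D \<rho> \<sigma>"
  using assms unfolding generalized_divergence_def by blast+

text \<open>Trace one rules out dimension zero. The supremum in \<open>amortized_div\<close> ranges
  over all \<open>r\<close>, and this makes \<open>r\<close> positive whenever an input state is
  given.\<close>

lemma state_pos:
  assumes "state a \<rho>"
  shows "0 < a"
  using assms by (cases a) (auto simp: state_def psd_def tr_def)

text \<open>Supplies the input that keeps \<open>amortized_div\<close> away from -\<infinity>; the
  witness is the projector onto the first basis vector.\<close>

lemma state_exists:
  assumes "0 < a"
  obtains \<rho> where "state a \<rho>"
proof
  let ?\<rho> = "mat a a (\<lambda>(i, j). if i = 0 \<and> j = 0 then 1 else 0 :: complex)"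
  have "(\<Sum>i<a. \<Sum>j<a. cnj (f i) * ?\<rho> $$ (i, j) * f j) = cnj (f 0) * f 0" for f
  proof -
    have "(\<Sum>i<a. \<Sum>j<a. cnj (f i) * ?\<rho> $$ (i, j) * f j)
        = (\<Sum>i<a. \<Sum>j<a. if i = 0 then if j = 0 then cnj (f 0) * f 0 else 0 else 0)"
      by (intro sum.cong) auto
    also have "\<dots> = (\<Sum>i<a. if i = 0 then cnj (f 0) * f 0 else 0)"
      using assms by (intro sum.cong) (auto simp: sum.delta)
    also have "\<dots> = cnj (f 0) * f 0" using assms by (simp add: sum.delta)
    finally show ?thesis .
  qed
  moreover have "0 \<le> cnj z * z" for z by (simp add: less_eq_complex_def)
  ultimately have "psd a ?\<rho>" by (simp add: psd_iff pos_semidef_def)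
  moreover have "tr ?\<rho> = 1" using assms by (simp add: tr_def sum.delta)
  ultimately show "state a ?\<rho>" by (simp add: state_def)
qed

lemma ext_state:
  assumes "channel a b N" "state (a * r) \<rho>"
  shows "state (b * r) (ext a b r N \<rho>)"
proof -
  have "0 < r" using state_pos[OF assms(2)] by simp
  thus ?thesis using channel_state channel_ext assms by blast
qed

text \<open>Additive form of the definition, free of subtraction. \<open>D \<rho> \<tau>\<close> is
  finite, since the last hypothesis excludes \<infinity> and \<open>generalized_divergence\<close>
  excludes -\<infinity>. \<open>amortized_div_least\<close> is the counterpart for upper
  bounds.\<close>

lemma amortized_div_bound:
  assumes "generalized_divergence D" "state (a * r) \<rho>" "state (a * r) \<tau>" "D \<rho> \<tau> < \<infinity>"
  shows "D (ext a b r N \<rho>) (ext a b r M \<tau>) \<le> amortized_div D a b N M + D \<rho> \<tau>"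
proof -
  have "D (ext a b r N \<rho>) (ext a b r M \<tau>) - D \<rho> \<tau> \<le> amortized_div D a b N M"
    unfolding amortized_div_def using assms by (intro Sup_upper) blast
  moreover have "\<bar>D \<rho> \<tau>\<bar> \<noteq> \<infinity>" using generalized_divergenceD(1)[OF assms(1-3)] assms(4) by auto
  ultimately show ?thesis by (simp add: ereal_minus_le_iff)
qed

lemma amortized_div_least:
  assumes "generalized_divergence D"
    and "\<And>r \<rho> \<tau>. state (a * r) \<rho> \<Longrightarrow> state (a * r) \<tau> \<Longrightarrow> D \<rho> \<tau> < \<infinity> \<Longrightarrow>
      D (ext a b r N \<rho>) (ext a b r M \<tau>) \<le> B + D \<rho> \<tau>"
  shows "amortized_div D a b N M \<le> B"
  unfolding amortized_div_def
proof (rule Sup_least, clarify)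
  fix r \<rho> \<tau> assume h: "state (a * r) \<rho>" "state (a * r) \<tau>" "D \<rho> \<tau> < \<infinity>"
  hence "\<bar>D \<rho> \<tau>\<bar> \<noteq> \<infinity>" using generalized_divergenceD(1)[OF assms(1)] by auto
  thus "D (ext a b r N \<rho>) (ext a b r M \<tau>) - D \<rho> \<tau> \<le> B"
    using assms(2)[OF h] by (auto simp: ereal_minus_le_iff)
qed

text \<open>Data processing under \<open>E\<close> sends an admissible input pair to an admissible
  one of no larger divergence, so the subtrahend does not grow; data processing under
  \<open>F\<close> bounds the output divergence.\<close>

lemma amortized_div_comp:
  assumes D: "generalized_divergence D"
    and E: "channel a' a E" and N: "channel a b N" and M: "channel a b M" and F: "channel b b' F"
  shows "amortized_div D a' b' (F \<circ> N \<circ> E) (F \<circ> M \<circ> E) \<le> amortized_div D a b N M"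
proof (rule amortized_div_least[OF D])
  fix r \<rho> \<tau> assume \<rho>: "state (a' * r) \<rho>" and \<tau>: "state (a' * r) \<tau>" and fin: "D \<rho> \<tau> < \<infinity>"
  have r: "0 < r" using state_pos[OF \<rho>] by simp
  let ?\<rho> = "ext a' a r E \<rho>" and ?\<tau> = "ext a' a r E \<tau>"
  have e: "ext a' b' r (F \<circ> K \<circ> E) X = ext b b' r F (ext a b r K (ext a' a r E X))"
    if "channel a b K" for K X
    using channelD(3)[OF E] channelD(3)[OF that] by (simp add: ext_comp o_assoc)
  have s: "state (a * r) ?\<rho>" "state (a * r) ?\<tau>" using ext_state[OF E] \<rho> \<tau> by auto
  have le: "D ?\<rho> ?\<tau> \<le> D \<rho> \<tau>"
    by (rule generalized_divergenceD(2)[OF D \<rho> \<tau> channel_ext[OF E r]])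
  have "D (ext a' b' r (F \<circ> N \<circ> E) \<rho>) (ext a' b' r (F \<circ> M \<circ> E) \<tau>)
      \<le> D (ext a b r N ?\<rho>) (ext a b r M ?\<tau>)"
    unfolding e[OF N] e[OF M] using ext_state[OF N s(1)] ext_state[OF M s(2)]
    by (rule generalized_divergenceD(2)[OF D]) (rule channel_ext[OF F r])
  also have "\<dots> \<le> amortized_div D a b N M + D ?\<rho> ?\<tau>"
    using le fin by (intro amortized_div_bound[OF D s]) auto
  also have "\<dots> \<le> amortized_div D a b N M + D \<rho> \<tau>" using le by (rule add_left_mono)
  finally show "D (ext a' b' r (F \<circ> N \<circ> E) \<rho>) (ext a' b' r (F \<circ> M \<circ> E) \<tau>)
      \<le> amortized_div D a b N M + D \<rho> \<tau>" .
qed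

lemma amortized_div_self:
  assumes D: "generalized_divergence D" and N: "channel a b N"
  shows "amortized_div D a b N N \<le> 0"
proof (rule amortized_div_least[OF D])
  fix r \<rho> \<tau> assume \<rho>: "state (a * r) \<rho>" and \<tau>: "state (a * r) \<tau>"
  have "0 < r" using state_pos[OF \<rho>] by simp
  from generalized_divergenceD(2)[OF D \<rho> \<tau> channel_ext[OF N this]]
  show "D (ext a b r N \<rho>) (ext a b r N \<tau>) \<le> 0 + D \<rho> \<tau>" by simp
qed

text \<open>The pair of equal inputs with trivial reference is admissible in the supremum, and its
  subtrahend \<open>D \<rho> \<rho>\<close> is at most 0.\<close>

lemma divergence_le_amortized_div:
  assumes D: "generalized_divergence D" and N: "channel a b N" and M: "channel a b M"
    and \<rho>: "state a \<rho>" and le: "D \<rho> \<rho> \<le> 0"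
  shows "D (N \<rho>) (M \<rho>) \<le> amortized_div D a b N M"
proof -
  have c: "\<rho> \<in> carrier_mat a a" by (rule state_carrier[OF \<rho>])
  have "D (ext a b 1 N \<rho>) (ext a b 1 M \<rho>) \<le> amortized_div D a b N M + D \<rho> \<rho>"
    using \<rho> le by (intro amortized_div_bound[OF D]) auto
  also have "\<dots> \<le> amortized_div D a b N M + 0" using le by (rule add_left_mono)
  finally show ?thesis
    using c channelD(3)[OF N c] channelD(3)[OF M c] by (simp add: ext_one[of _ a _ b])
qed

text \<open>Lets \<open>amortized_div\<close> be moved across an inequality when it is the
  subtrahend of the superchannel divergence.\<close>

lemma amortized_div_not_MInf:
  assumes D: "generalized_divergence D" and refl: "\<And>k \<omega>. state k \<omega> \<Longrightarrow> D \<omega> \<omega> \<le> 0"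
    and N: "channel a b N" and M: "channel a b M"
  shows "amortized_div D a b N M \<noteq> -\<infinity>"
proof -
  obtain \<rho> where \<rho>: "state a \<rho>" using state_exists channelD(1)[OF N] by blast
  have "D (N \<rho>) (M \<rho>) \<noteq> -\<infinity>"
    by (rule generalized_divergenceD(1)[OF D channel_state[OF N \<rho>] channel_state[OF M \<rho>]])
  with divergence_le_amortized_div[OF D N M \<rho> refl[OF \<rho>]] show ?thesis by auto
qed

lemma amortized_superdiv_bound:
  assumes D: "generalized_divergence D" and refl: "\<And>k \<omega>. state k \<omega> \<Longrightarrow> D \<omega> \<omega> \<le> 0"
    and N: "channel (a * r) (b * r) N" and M: "channel (a * r) (b * r) M"
    and fin: "amortized_div D (a * r) (b * r) N M < \<infinity>"
  shows "amortized_div D (c * r) (d * r) (superapply a b c d \<Theta>\<^sub>1 r N) (superapply a b c d \<Theta>\<^sub>2 r M)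
    \<le> amortized_superdiv D a b c d \<Theta>\<^sub>1 \<Theta>\<^sub>2 + amortized_div D (a * r) (b * r) N M"
proof -
  have "amortized_div D (c * r) (d * r) (superapply a b c d \<Theta>\<^sub>1 r N) (superapply a b c d \<Theta>\<^sub>2 r M)
      - amortized_div D (a * r) (b * r) N M \<le> amortized_superdiv D a b c d \<Theta>\<^sub>1 \<Theta>\<^sub>2"
    unfolding amortized_superdiv_def using N M fin by (intro Sup_upper) blast
  moreover have "\<bar>amortized_div D (a * r) (b * r) N M\<bar> \<noteq> \<infinity>"
    using amortized_div_not_MInf[OF D refl N M] fin by auto
  ultimately show ?thesis by (simp add: ereal_minus_le_iff)
qed

section \<open>Nested strategies\<close>

text \<open>\<open>nested\<close> recurses from \<open>Suc (Suc k)\<close> because round 0 is a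
  dummy; this form fits an induction that starts at 1.\<close>

lemma nested_Suc:
  "1 \<le> i \<Longrightarrow> nested a b c d \<Theta> n R A (Suc i) =
    superapply a b c d \<Theta> (R (i + 1)) (A (n - i) \<circ> nested a b c d \<Theta> n R A i \<circ> A (n + i))"
  by (cases i) (auto simp: Let_def)

lemma channel_nested:
  assumes \<Theta>: "is_superchannel a b c d \<Theta>" and A: "nested_strategy a b c d n R A"
    and "1 \<le> i" "i \<le> n"
  shows "channel (c * R i) (d * R i) (nested a b c d \<Theta> n R A i)"
  using assms(3,4)
proof (induction i rule: nat_induct_at_least)
  case base
  show ?case using channel_superapply[OF \<Theta>] A by (simp add: nested_strategy_def)
next
  case (Suc i)
  have i: "i \<in> {1..<n}" using Suc by auto
  have "channel (a * R (i + 1)) (b * R (i + 1))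
      (A (n - i) \<circ> nested a b c d \<Theta> n R A i \<circ> A (n + i))"
    using A i Suc unfolding nested_strategy_def by (intro channel_comp) auto
  from channel_superapply[OF \<Theta> this] show ?case
    by (simp only: nested_Suc[OF Suc.hyps] Suc_eq_plus1[symmetric])
qed

lemma amortized_div_nested:
  assumes D: "generalized_divergence D" and refl: "\<And>k \<omega>. state k \<omega> \<Longrightarrow> D \<omega> \<omega> \<le> 0"
    and \<Theta>\<^sub>1: "is_superchannel a b c d \<Theta>\<^sub>1" and \<Theta>\<^sub>2: "is_superchannel a b c d \<Theta>\<^sub>2"
    and A: "nested_strategy a b c d n R A" and "1 \<le> n"
  shows "amortized_div D (c * R n) (d * R n)
      (nested a b c d \<Theta>\<^sub>1 n R A n) (nested a b c d \<Theta>\<^sub>2 n R A n)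
    \<le> ereal (real n) * amortized_superdiv D a b c d \<Theta>\<^sub>1 \<Theta>\<^sub>2"
proof -
  define S where "S = amortized_superdiv D a b c d \<Theta>\<^sub>1 \<Theta>\<^sub>2"
  let ?N = "nested a b c d \<Theta>\<^sub>1 n R A" and ?M = "nested a b c d \<Theta>\<^sub>2 n R A"
  have An: "channel (a * R 1) (b * R 1) (A n)" using A by (simp add: nested_strategy_def)
  have self: "amortized_div D (a * R 1) (b * R 1) (A n) (A n) \<le> 0"
    by (rule amortized_div_self[OF D An])
  \<comment> \<open>Both superchannels receive the same channel \<open>A n\<close> here, and its
    amortized divergence from itself is finite from above, hence admissible in the supremum.\<close>
  have "amortized_div D (c * R 1) (d * R 1) (?N 1) (?M 1)
      \<le> S + amortized_div D (a * R 1) (b * R 1) (A n) (A n)"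
    unfolding S_def One_nat_def nested.simps(2)
    using self by (intro amortized_superdiv_bound[OF D refl]) (use An in auto)
  also have "\<dots> \<le> S + 0" using self by (rule add_left_mono)
  finally have one: "amortized_div D (c * R 1) (d * R 1) (?N 1) (?M 1) \<le> S" by simp
  \<comment> \<open>The first round also excludes \<open>S = -\<infinity>\<close>, as a quantity
    other than -\<infinity> lies below \<open>S\<close>.\<close>
  moreover have "amortized_div D (c * R 1) (d * R 1) (?N 1) (?M 1) \<noteq> -\<infinity>"
    using assms(6) by (intro amortized_div_not_MInf[OF D refl] channel_nested \<Theta>\<^sub>1 \<Theta>\<^sub>2 A) auto
  ultimately have S_ninf: "S \<noteq> -\<infinity>" by auto
  show ?thesis
  proof (cases "S = \<infinity>")
    case True
    \<comment> \<open>Here \<open>1 \<le> n\<close> matters: in the extended reals 0 times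
      \<infinity> is 0.\<close>
    thus ?thesis using assms(6) by (simp add: S_def[symmetric])
  next
    case False
    with S_ninf obtain s where s: "S = ereal s" by (cases S) auto
    \<comment> \<open>The induction runs over \<open>i\<close> with \<open>n\<close> fixed, because
      the indices \<open>n - i\<close> and \<open>n + i\<close> of the interposed channels refer to
      the total number of rounds.\<close>
    have "amortized_div D (c * R i) (d * R i) (?N i) (?M i) \<le> ereal (real i) * S"
      if "1 \<le> i" "i \<le> n" for i
      using that
    proof (induction i rule: nat_induct_at_least)
      case base
      show ?case using one by simp
    next
      case (Suc i)
      have i: "i \<in> {1..<n}" using Suc by auto
      let ?r = "R (i + 1)"
      let ?N' = "A (n - i) \<circ> ?N i \<circ> A (n + i)" and ?M' = "A (n - i) \<circ> ?M i \<circ> A (n + i)"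
      have E: "channel (a * ?r) (c * R i) (A (n + i))" and F: "channel (d * R i) (b * ?r) (A (n - i))"
        using A i by (auto simp: nested_strategy_def)
      have N: "channel (c * R i) (d * R i) (?N i)" and M: "channel (c * R i) (d * R i) (?M i)"
        using i by (auto intro: channel_nested \<Theta>\<^sub>1 \<Theta>\<^sub>2 A)
      have N': "channel (a * ?r) (b * ?r) ?N'" and M': "channel (a * ?r) (b * ?r) ?M'"
        using E F N M by (auto intro: channel_comp)
      have le: "amortized_div D (a * ?r) (b * ?r) ?N' ?M' \<le> ereal (real i) * S"
        using amortized_div_comp[OF D E N M F] Suc by (meson Suc_leD order_trans)
      \<comment> \<open>As \<open>S\<close> is real, the bound of the previous round makes this pair
        admissible in the supremum defining \<open>amortized_superdiv\<close>.\<close>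
      hence "amortized_div D (a * ?r) (b * ?r) ?N' ?M' < \<infinity>" by (auto simp: s)
      hence "amortized_div D (c * ?r) (d * ?r) (superapply a b c d \<Theta>\<^sub>1 ?r ?N') (superapply a b c d \<Theta>\<^sub>2 ?r ?M')
          \<le> S + amortized_div D (a * ?r) (b * ?r) ?N' ?M'"
        unfolding S_def by (intro amortized_superdiv_bound D refl N' M')
      also have "\<dots> \<le> S + ereal (real i) * S" using le by (rule add_left_mono)
      also have "\<dots> = ereal (real (Suc i)) * S" by (simp add: s algebra_simps)
      finally show ?case by (simp only: nested_Suc[OF Suc.hyps] Suc_eq_plus1[symmetric])
    qed
    with assms(6) show ?thesis by (simp add: S_def)
  qed
qed

theorem theorem5p3:
  fixes D :: "complex mat \<Rightarrow> complex mat \<Rightarrow> ereal"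
    and a b c d n :: nat
    and \<Theta>\<^sub>1 \<Theta>\<^sub>2 :: superchannel
    and R :: "nat \<Rightarrow> nat"
    and A :: "nat \<Rightarrow> supop"
    and \<rho> :: "complex mat"
    and Q :: "nat \<Rightarrow> complex mat"
    and N\<^sub>n M\<^sub>n :: supop
    and p q :: "nat \<Rightarrow> real"
  assumes "generalized_divergence D"
    and "\<And>k \<omega>. state k \<omega> \<Longrightarrow> D \<omega> \<omega> \<le> 0"
    and "is_superchannel a b c d \<Theta>\<^sub>1"
    and "is_superchannel a b c d \<Theta>\<^sub>2"
    and "n \<ge> 1"
    and "nested_strategy a b c d n R A"
    and "state (c * R n) \<rho>"
    and "binary_measurement (d * R n) Q"
    and "N\<^sub>n = nested a b c d \<Theta>\<^sub>1 n R A n"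
    and "M\<^sub>n = nested a b c d \<Theta>\<^sub>2 n R A n"
    and "p = outcome_dist Q (N\<^sub>n \<rho>)"
    and "q = outcome_dist Q (M\<^sub>n \<rho>)"
  shows "D (diag_state p) (diag_state q) \<le> D (N\<^sub>n \<rho>) (M\<^sub>n \<rho>) \<and>
         D (N\<^sub>n \<rho>) (M\<^sub>n \<rho>) \<le> ereal (real n) * amortized_superdiv D a b c d \<Theta>\<^sub>1 \<Theta>\<^sub>2"
proof -
  note D = assms(1) and refl = assms(2) and \<Theta>\<^sub>1 = assms(3) and \<Theta>\<^sub>2 = assms(4) and n = assms(5)
    and A = assms(6) and \<rho> = assms(7) and Q = assms(8)
  have N: "channel (c * R n) (d * R n) N\<^sub>n"
    unfolding assms(9) using channel_nested[OF \<Theta>\<^sub>1 A n] by simp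
  have M: "channel (c * R n) (d * R n) M\<^sub>n"
    unfolding assms(10) using channel_nested[OF \<Theta>\<^sub>2 A n] by simp
  have s: "state (d * R n) (N\<^sub>n \<rho>)" "state (d * R n) (M\<^sub>n \<rho>)"
    using channel_state[OF N \<rho>] channel_state[OF M \<rho>] by auto
  have "diag_state p = measure_channel Q (N\<^sub>n \<rho>)" "diag_state q = measure_channel Q (M\<^sub>n \<rho>)"
    unfolding assms(11,12) using s by (auto intro!: diag_state_outcome[OF Q] simp: state_def)
  hence "D (diag_state p) (diag_state q) \<le> D (N\<^sub>n \<rho>) (M\<^sub>n \<rho>)"
    using generalized_divergenceD(2)[OF D s channel_measure[OF Q state_pos[OF s(1)]]] by simp
  moreover have "D (N\<^sub>n \<rho>) (M\<^sub>n \<rho>) \<le> amortized_div D (c * R n) (d * R n) N\<^sub>n M\<^sub>n"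
    by (rule divergence_le_amortized_div[OF D N M \<rho> refl[OF \<rho>]])
  moreover have "\<dots> \<le> ereal (real n) * amortized_superdiv D a b c d \<Theta>\<^sub>1 \<Theta>\<^sub>2"
    unfolding assms(9,10) by (rule amortized_div_nested[OF D refl \<Theta>\<^sub>1 \<Theta>\<^sub>2 A n])
  ultimately show ?thesis by auto
qed

end
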